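(* Let $n\ge 3$ and let $A=(a_{i,j})_{i,j=1}^n$ be a real and normal $n\times n$ matrix. Assume $\lambda$ and $\mu$ are distinct eigenvalues of $A$. Then there is some $i\in\{1,\ldots,n\}$ such that both $\lambda$ and $\mu$ lie in the disk $D(a_{i,i},\rho_i)$, where $\rho_i=r_i+\sqrt n\,|\lambda-\mu|$.
   Context: $D(a,r)=\{z\in\mathbb{C}: |z-a|\le r\}$ is the closed disk in the complex plane with centre $a$ and radius $r$. For a real $n\times n$ matrix $A$ and $i\in\{1,\ldots,n\}$, let $t_i$ be a median of the $n$ numbers $a_{i,1},\ldots,a_{i,i-1},0,a_{i,i+1},\ldots,a_{i,n}$ (row $i$ with the diagonal entry $a_{i,i}$ replaced by $0$), and set $r_i=|t_i|+\sum_{j\ne i}|a_{i,j}-t_i|$ (when $n$ is even any point between the two middle values may be taken as median; $r_i$ does not depend on the choice). A matrix is called normal if its eigenvectors belonging to distinct eigenvalues are orthogonal (with respect to the standard Hermitian inner product on $\mathbb{C}^n$). Eigenvalues may be complex. *)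

theory Defs
  imports
    "Jordan_Normal_Form.Char_Poly"
    "Jordan_Normal_Form.Conjugate"
    "HOL-Analysis.Elementary_Metric_Spaces"
begin

text \<open>
  Matrices and vectors are those of \<open>Jordan_Normal_Form\<close>; indices run from \<open>0\<close> to \<open>n - 1\<close>.
  A real matrix is embedded into the complex matrices before eigenvalues and eigenvectors are
  taken, so both may be non-real.
\<close>

abbreviation cmat :: "real mat \<Rightarrow> complex mat" where
  "cmat A \<equiv> map_mat complex_of_real A"

text \<open>
  This is not the condition that \<open>A\<close> commutes with its adjoint: diagonalizability is not
  required.  The product \<open>\<bullet>c\<close> is the standard Hermitian inner product.
\<close>

definition normal_mat :: "complex mat \<Rightarrow> bool" where
  "normal_mat A \<longleftrightarrow>
    (\<forall>lam mu v w. eigenvector A v lam \<longrightarrow> eigenvector A w mu \<longrightarrow> lam \<noteq> mu \<longrightarrow> v \<bullet>c w = 0)"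

text \<open>
  For odd length the two indices coincide with the middle position of the sorted list; for even
  length they are the two middle positions.
\<close>

definition is_median :: "real list \<Rightarrow> real \<Rightarrow> bool" where
  "is_median xs t \<longleftrightarrow>
    xs \<noteq> [] \<and> sort xs ! ((length xs - 1) div 2) \<le> t \<and> t \<le> sort xs ! (length xs div 2)"

lemma is_median_exists:
  assumes "xs \<noteq> []"
  shows "\<exists>t. is_median xs t"
proof -
  have "sort xs ! ((length xs - 1) div 2) \<le> sort xs ! (length xs div 2)"
    using assms by (intro sorted_nth_mono) (auto intro: div_le_mono)
  then show ?thesis
    using assms unfolding is_median_def by blast
qed

definition row_diag0 :: "real mat \<Rightarrow> nat \<Rightarrow> real list" where
  "row_diag0 A i = map (\<lambda>j. if j = i then 0 else A $$ (i, j)) [0..<dim_col A]"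

definition med_radius :: "real mat \<Rightarrow> nat \<Rightarrow> real \<Rightarrow> real" where
  "med_radius A i t = \<bar>t\<bar> + (\<Sum>j\<in>{0..<dim_col A} - {i}. \<bar>A $$ (i, j) - t\<bar>)"

end

theory Submission
  imports Defs
begin

text \<open>
  Some nonzero combination \<open>v = x + y\<close> of eigenvectors for the two eigenvalues has coordinate sum
  \<open>0\<close>, so in each row the off-diagonal entries may be shifted by \<open>t i\<close> without changing the action
  on \<open>v\<close>, except for a term \<open>t i * v i\<close>. Now \<open>A v = lam v + (mu - lam) y\<close>, and at a coordinate \<open>i\<close>
  where \<open>\<bar>v i\<bar>\<close> is maximal, orthogonality gives
  \<open>\<bar>y i\<bar> \<le> \<parallel>y\<parallel> \<le> \<parallel>v\<parallel> \<le> sqrt n * \<bar>v i\<bar>\<close>. The roles of \<open>x\<close> and \<open>y\<close> are symmetric, so the same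
  \<open>i\<close> serves both eigenvalues.
\<close>

lemma sum_cmod_square_add_orthogonal:
  fixes x y :: "'a \<Rightarrow> complex"
  assumes "(\<Sum>j\<in>I. x j * cnj (y j)) = 0"
  shows "(\<Sum>j\<in>I. (cmod (x j + y j))\<^sup>2) = (\<Sum>j\<in>I. (cmod (x j))\<^sup>2) + (\<Sum>j\<in>I. (cmod (y j))\<^sup>2)"
proof -
  have "(cmod (x j + y j))\<^sup>2 = (cmod (x j))\<^sup>2 + (cmod (y j))\<^sup>2 + 2 * Re (x j * cnj (y j))" for j
    unfolding cmod_power2 by (simp add: power2_eq_square algebra_simps)
  moreover have "(\<Sum>j\<in>I. Re (x j * cnj (y j))) = 0"
    using assms by (metis Re_sum zero_complex.sel(1))
  ultimately show ?thesis
    by (simp add: sum.distrib flip: sum_distrib_left)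
qed

text \<open>The factor \<open>sqrt n\<close> of the radius originates here. Pythagoras lets the mass
  of \<open>x\<close> be dropped from that of \<open>x + y\<close>, and maximality of coordinate
  \<open>i\<close> bounds each of the remaining squares.\<close>

lemma cmod_le_sqrt_card_times_max:
  fixes x y :: "'a \<Rightarrow> complex"
  assumes "finite I" "i \<in> I"
    and orth: "(\<Sum>j\<in>I. x j * cnj (y j)) = 0"
    and max: "\<And>j. j \<in> I \<Longrightarrow> cmod (x j + y j) \<le> cmod (x i + y i)"
  shows "cmod (y i) \<le> sqrt (card I) * cmod (x i + y i)"
proof -
  have "(cmod (y i))\<^sup>2 \<le> (\<Sum>j\<in>I. (cmod (y j))\<^sup>2)"
    using assms(1,2) by (intro member_le_sum) auto
  also have "\<dots> \<le> (\<Sum>j\<in>I. (cmod (x j + y j))\<^sup>2)"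
    by (simp add: sum_cmod_square_add_orthogonal[OF orth] sum_nonneg)
  also have "\<dots> \<le> (\<Sum>j\<in>I. (cmod (x i + y i))\<^sup>2)"
    by (intro sum_mono power_mono max) auto
  finally have "(cmod (y i))\<^sup>2 \<le> (sqrt (card I) * cmod (x i + y i))\<^sup>2"
    by (simp add: power_mult_distrib)
  then show ?thesis
    by (rule power2_le_imp_le) simp
qed

text \<open>Gershgorin's estimate for a row whose off-diagonal entries are shifted by
  \<open>t\<close>. The summand \<open>\<bar>t\<bar>\<close> of \<open>med_radius\<close> pays for
  the shift.\<close>

lemma cmod_row_le_med_radius:
  fixes v :: "nat \<Rightarrow> complex"
  assumes dim: "dim_col A = n" and i: "i < n"
    and sum0: "(\<Sum>j<n. v j) = 0"
    and max: "\<And>j. j < n \<Longrightarrow> cmod (v j) \<le> cmod (v i)"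
  shows "cmod ((\<Sum>j<n. A $$ (i, j) * v j) - A $$ (i, i) * v i) \<le> med_radius A i t * cmod (v i)"
proof -
  let ?J = "{0..<n} - {i}"
  have split: "sum f {..<n} = f i + sum f ?J" for f :: "nat \<Rightarrow> complex"
    using i by (subst sum.remove[of _ i]) (auto simp: lessThan_atLeast0)
  \<comment> \<open>Hence subtracting \<open>t\<close> from the off-diagonal entries adds
    \<open>t * v i\<close> to the row sum, which the next identity takes off again.\<close>
  have "(\<Sum>j\<in>?J. v j) = - v i"
    using sum0 unfolding split by (metis minus_unique)
  then have "(\<Sum>j<n. A $$ (i, j) * v j) - A $$ (i, i) * v i
      = (\<Sum>j\<in>?J. complex_of_real (A $$ (i, j) - t) * v j) - t * v i"
    unfolding split by (simp add: left_diff_distrib sum_subtractf flip: sum_distrib_left)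
  also have "cmod \<dots> \<le> cmod (\<Sum>j\<in>?J. complex_of_real (A $$ (i, j) - t) * v j) + cmod (t * v i)"
    by (rule norm_triangle_ineq4)
  also have "\<dots> \<le> (\<Sum>j\<in>?J. \<bar>A $$ (i, j) - t\<bar> * cmod (v i)) + \<bar>t\<bar> * cmod (v i)"
    by (intro add_mono sum_norm_le)
      (auto simp: norm_mult max mult_left_mono simp del: of_real_diff)
  also have "\<dots> = med_radius A i t * cmod (v i)"
    by (simp add: med_radius_def dim algebra_simps sum_distrib_left)
  finally show ?thesis .
qed

text \<open>Gershgorin's argument for an approximate eigenvector: in row \<open>i\<close>,
  \<open>x + y\<close> fails the equation for \<open>lam\<close> only by
  \<open>(mu - lam) * y i\<close>, which costs at most \<open>sqrt n * cmod (lam - mu)\<close>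
  relative to \<open>cmod (x i + y i)\<close>.\<close>

lemma eigenvalue_in_cball_med_radius:
  fixes x y :: "nat \<Rightarrow> complex"
  assumes dim: "dim_col A = n" and i: "i < n"
    and x: "(\<Sum>j<n. A $$ (i, j) * x j) = lam * x i"
    and y: "(\<Sum>j<n. A $$ (i, j) * y j) = mu * y i"
    and orth: "(\<Sum>j<n. x j * cnj (y j)) = 0"
    and sum0: "(\<Sum>j<n. x j + y j) = 0"
    and max: "\<And>j. j < n \<Longrightarrow> cmod (x j + y j) \<le> cmod (x i + y i)"
    and nz: "x i + y i \<noteq> 0"
  shows "lam \<in> cball (complex_of_real (A $$ (i, i))) (med_radius A i t + sqrt n * cmod (lam - mu))"
proof -
  let ?v = "x i + y i" and ?S = "\<Sum>j<n. A $$ (i, j) * (x j + y j)"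
  have "?S = lam * x i + mu * y i"
    by (simp add: distrib_left sum.distrib x y)
  then have eq: "(lam - A $$ (i, i)) * ?v = (?S - A $$ (i, i) * ?v) + (lam - mu) * y i"
    by (simp add: algebra_simps)
  have "cmod (lam - A $$ (i, i)) * cmod ?v
      \<le> cmod (?S - A $$ (i, i) * ?v) + cmod (lam - mu) * cmod (y i)"
    unfolding norm_mult[symmetric] eq by (rule norm_triangle_ineq)
  also have "\<dots> \<le> med_radius A i t * cmod ?v + cmod (lam - mu) * (sqrt n * cmod ?v)"
    using cmod_row_le_med_radius[OF dim i sum0 max]
      cmod_le_sqrt_card_times_max[of "{..<n}" i x y] i orth max
    by (intro add_mono mult_left_mono) auto
  finally have "cmod (lam - A $$ (i, i)) * cmod ?v
      \<le> (med_radius A i t + sqrt n * cmod (lam - mu)) * cmod ?v"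
    by (simp add: algebra_simps)
  then show ?thesis
    using nz by (simp add: dist_norm norm_minus_commute)
qed

lemma eigenvector_rowD:
  assumes "A \<in> carrier_mat n n" "eigenvector (cmat A) v lam" "i < n"
  shows "(\<Sum>j<n. A $$ (i, j) * v $ j) = lam * v $ i"
proof -
  have v: "v \<in> carrier_vec n" "cmat A *\<^sub>v v = lam \<cdot>\<^sub>v v"
    using assms(1,2) by (auto simp: eigenvector_def)
  have "(cmat A *\<^sub>v v) $ i = (\<Sum>j<n. A $$ (i, j) * v $ j)"
    using assms(1,3) v(1) by (auto simp: scalar_prod_def lessThan_atLeast0 intro!: sum.cong)
  then show ?thesis
    using v assms(3) by simp
qed

lemma exists_combination_sum_zero:
  fixes x y :: "'a \<Rightarrow> complex"
  obtains \<alpha> \<beta> where "(\<Sum>j\<in>I. \<alpha> * x j + \<beta> * y j) = 0" "\<alpha> \<noteq> 0 \<or> \<beta> \<noteq> 0"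
proof (cases "(\<Sum>j\<in>I. x j) = 0")
  case True
  then show ?thesis
    using that[of 1 0] by simp
next
  case False
  then show ?thesis
    \<comment> \<open>The coefficients are the two coordinate sums exchanged, one with its sign
      changed; the second is nonzero in this case.\<close>
    using that[of "\<Sum>j\<in>I. y j" "- (\<Sum>j\<in>I. x j)"]
    by (simp add: sum_subtractf mult.commute flip: sum_distrib_left sum_distrib_right)
qed

theorem theorem5p1:
  fixes n :: nat and A :: "real mat" and lam mu :: complex and t :: "nat \<Rightarrow> real"
  assumes "n \<ge> 3"
    and "A \<in> carrier_mat n n"
    and "normal_mat (cmat A)"
    and "\<And>i. i < n \<Longrightarrow> is_median (row_diag0 A i) (t i)"
    and "eigenvalue (cmat A) lam"
    and "eigenvalue (cmat A) mu"
    and "lam \<noteq> mu"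
  shows "\<exists>i<n. {lam, mu} \<subseteq>
    cball (complex_of_real (A $$ (i, i))) (med_radius A i (t i) + sqrt (real n) * cmod (lam - mu))"
proof -
  obtain x y where x: "eigenvector (cmat A) x lam" and y: "eigenvector (cmat A) y mu"
    using assms(5,6) unfolding eigenvalue_def by blast
  have dim: "dim_vec x = n" "dim_vec y = n" and "x \<noteq> 0\<^sub>v n" "y \<noteq> 0\<^sub>v n"
    using x y assms(2) by (auto simp: eigenvector_def)
  then have nz: "\<exists>j<n. x $ j \<noteq> 0" "\<exists>j<n. y $ j \<noteq> 0"
    by (auto simp: vec_eq_iff)
  have "x \<bullet>c y = 0"
    using assms(3,7) x y unfolding normal_mat_def by blast
  then have orth: "(\<Sum>j<n. x $ j * cnj (y $ j)) = 0"
    by (simp add: scalar_prod_def dim lessThan_atLeast0)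
  obtain \<alpha> \<beta> where sum0: "(\<Sum>j<n. \<alpha> * x $ j + \<beta> * y $ j) = 0" and \<alpha>\<beta>: "\<alpha> \<noteq> 0 \<or> \<beta> \<noteq> 0"
    by (rule exists_combination_sum_zero)
  \<comment> \<open>One of \<open>x'\<close> and \<open>y'\<close> may vanish identically, so they
    need not be eigenvectors, but they inherit the row equations and the orthogonality.\<close>
  define x' where "x' = (\<lambda>j. \<alpha> * x $ j)"
  define y' where "y' = (\<lambda>j. \<beta> * y $ j)"
  have "(\<Sum>j<n. x' j * cnj (y' j)) = \<alpha> * cnj \<beta> * (\<Sum>j<n. x $ j * cnj (y $ j))"
    by (simp add: x'_def y'_def sum_distrib_left mult_ac)
  then have orth': "(\<Sum>j<n. x' j * cnj (y' j)) = 0"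
    by (simp add: orth)
  from arg_cong[OF this, of cnj] have orth'': "(\<Sum>j<n. y' j * cnj (x' j)) = 0"
    by (simp add: mult.commute)
  have rows: "(\<Sum>j<n. A $$ (i, j) * x' j) = lam * x' i" "(\<Sum>j<n. A $$ (i, j) * y' j) = mu * y' i"
    if "i < n" for i
    using arg_cong[OF eigenvector_rowD[OF assms(2) x that], of "(*) \<alpha>"]
      arg_cong[OF eigenvector_rowD[OF assms(2) y that], of "(*) \<beta>"]
    by (simp_all add: x'_def y'_def sum_distrib_left mult_ac)
  have "Max ((\<lambda>j. cmod (x' j + y' j)) ` {..<n}) \<in> (\<lambda>j. cmod (x' j + y' j)) ` {..<n}"
    using assms(1) by (intro Max_in) (auto simp: lessThan_empty_iff)
  then obtain i where i: "i < n" and "cmod (x' i + y' i) = Max ((\<lambda>j. cmod (x' j + y' j)) ` {..<n})"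
    by fastforce
  then have max: "cmod (x' j + y' j) \<le> cmod (x' i + y' i)" if "j < n" for j
    using that by simp
  \<comment> \<open>Orthogonality stands in for linear independence: if the largest coordinate were
    zero, then \<open>x' + y'\<close> would vanish, and Pythagoras would make both summands
    vanish.\<close>
  have "x' i + y' i \<noteq> 0"
  proof
    assume "x' i + y' i = 0"
    then have "(\<Sum>j<n. (cmod (x' j + y' j))\<^sup>2) = 0"
      using max by simp
    then have "(\<Sum>j<n. (cmod (x' j))\<^sup>2) + (\<Sum>j<n. (cmod (y' j))\<^sup>2) = 0"
      by (simp add: sum_cmod_square_add_orthogonal[OF orth'])
    then have "\<forall>j<n. x' j = 0 \<and> y' j = 0"
      by (simp add: add_nonneg_eq_0_iff sum_nonneg sum_nonneg_eq_0_iff)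
    then show False
      using \<alpha>\<beta> nz by (auto simp: x'_def y'_def)
  qed
  then show ?thesis
    \<comment> \<open>The choice of \<open>i\<close> depends only on \<open>x' + y'\<close>, so the
      summands may be exchanged to obtain the disk for \<open>mu\<close>.\<close>
    using eigenvalue_in_cball_med_radius[of A n i x' lam y' mu "t i"]
      eigenvalue_in_cball_med_radius[of A n i y' mu x' lam "t i"]
      assms(2) i rows[OF i] orth' orth'' sum0 max
    by (auto simp: add.commute norm_minus_commute x'_def y'_def)
qed

end
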